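(* Let $a,b,c,d,e,k\in\mathbb{R}$ and consider the autonomous differential system $$\dot{x} = a(y-x)+yz,\qquad \dot{y} = b(x+y)-xz,\qquad \dot{z} = -cz-ew+xy,\qquad \dot{w} = -dw+kz+xy$$ on $\mathbb{R}^4$. The equilibrium point $E_0=(0,0,0,0)$ is a zero-Hopf equilibrium of this system if and only if $$a=b=0,\qquad d=-c,\qquad \omega^2=ek-c^2>0.$$
   Context: An equilibrium of a four-dimensional autonomous differential system is called a zero-Hopf equilibrium if the eigenvalues (counted with multiplicity) of the Jacobian matrix of the system at that point are $0,0,i\omega,-i\omega$ for some real $\omega>0$. The $\omega$ in the statement is this number. *)

theory Defs
  imports
    "HOL-Analysis.Analysis"
    "HOL-Computational_Algebra.Computational_Algebra"
begin

lemma vector_4 [simp]: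
  fixes x y z w :: "'a::zero"
  shows "(vector [x, y, z, w] :: 'a ^ 4) $ 1 = x"
    "(vector [x, y, z, w] :: 'a ^ 4) $ 2 = y"
    "(vector [x, y, z, w] :: 'a ^ 4) $ 3 = z"
    "(vector [x, y, z, w] :: 'a ^ 4) $ 4 = w"
  unfolding vector_def by simp_all

(* det (X I - A) *)
definition charpoly :: "'a::comm_ring_1 ^ 'n ^ 'n \<Rightarrow> 'a poly" where
  "charpoly A = det (mat [:0, 1:] - (\<chi> i j. [:A $ i $ j:]))"

(* The complex eigenvalues of a real matrix, with algebraic multiplicity. *)
definition eigenvalues_mset :: "real ^ 'n ^ 'n \<Rightarrow> complex multiset" where
  "eigenvalues_mset A = proots (charpoly (\<chi> i j. complex_of_real (A $ i $ j)))"

definition zero_hopf_equilibrium_at_frequency ::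
    "(real ^ 4 \<Rightarrow> real ^ 4) \<Rightarrow> real ^ 4 \<Rightarrow> real \<Rightarrow> bool" where
  "zero_hopf_equilibrium_at_frequency F p \<omega> \<longleftrightarrow>
     F p = 0 \<and> F differentiable (at p) \<and> \<omega> > 0 \<and>
     eigenvalues_mset (jacobian F (at p)) =
       {#0, 0, \<i> * complex_of_real \<omega>, - (\<i> * complex_of_real \<omega>)#}"

definition zero_hopf_equilibrium :: "(real ^ 4 \<Rightarrow> real ^ 4) \<Rightarrow> real ^ 4 \<Rightarrow> bool" where
  "zero_hopf_equilibrium F p \<longleftrightarrow> (\<exists>\<omega>. zero_hopf_equilibrium_at_frequency F p \<omega>)"

definition vector_field ::
    "real \<Rightarrow> real \<Rightarrow> real \<Rightarrow> real \<Rightarrow> real \<Rightarrow> real \<Rightarrow> real ^ 4 \<Rightarrow> real ^ 4" where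
  "vector_field a b c d e k u =
     (let x = u $ 1; y = u $ 2; z = u $ 3; w = u $ 4 in
      vector [a * (y - x) + y * z,
              b * (x + y) - x * z,
              - c * z - e * w + x * y,
              - d * w + k * z + x * y])"

end

theory Submission
  imports Defs
begin

(* With $ also denoting coefficients of power series, a term with n occurrences of it would have
   2^n parse trees. *)
no_notation fps_nth (infixl "$" 75)

text \<open>
  At the origin the linearised system decouples: $(x, y)$ and $(z, w)$ do not interact, so the
  Jacobian is block diagonal with two $2 \times 2$ blocks, and the characteristic polynomial is
  \[ (X^2 + (a - b) X - 2ab)\,(X^2 + (c + d) X + (cd + ek)). \]
  A monic complex polynomial is determined by its multiset of roots, so the spectrum is
  $0, 0, i\omega, -i\omega$ exactly if this product is $X^2 (X^2 + \omega^2)$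
  (\<open>proots_eq_iff_of_monic\<close>). Both factors being real, one of them must be $X^2$ and the other
  $X^2 + \omega^2$ (\<open>real_quadratic_product_eq_hopf_iff\<close>). The first factor cannot be
  $X^2 + \omega^2$: vanishing of its linear coefficient forces $a = b$, and then its constant
  coefficient $-2a^2$ is not positive. Hence the first factor is $X^2$, which means $a = b = 0$,
  and the second is $X^2 + \omega^2$, which means $d = -c$ and $\omega^2 = cd + ek = ek - c^2$.
\<close>

lemma det_block_lower_triangular_4:
  fixes A :: "'a::comm_ring_1 ^ 4 ^ 4"
  assumes "A $ 1 $ 3 = 0" "A $ 1 $ 4 = 0" "A $ 2 $ 3 = 0" "A $ 2 $ 4 = 0"
  shows "det A = (A $ 1 $ 1 * A $ 2 $ 2 - A $ 1 $ 2 * A $ 2 $ 1)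
               * (A $ 3 $ 3 * A $ 4 $ 4 - A $ 3 $ 4 * A $ 4 $ 3)"
proof -
  have f: "finite {2::4, 3, 4}" "1 \<notin> {2::4, 3, 4}" "finite {3::4, 4}" "2 \<notin> {3::4, 4}"
    "finite {4::4}" "3 \<notin> {4::4}"
    by auto
  show ?thesis
    unfolding det_def UNIV_4
    unfolding sum_over_permutations_insert[OF f(1,2)]
    unfolding sum_over_permutations_insert[OF f(3,4)]
    unfolding sum_over_permutations_insert[OF f(5,6)]
    unfolding permutes_sing
    by (simp add: sign_swap_id sign_compose permutation_swap_id permutation_compose sign_id
        transpose_eq_iff transpose_def assms algebra_simps)
qed

lemma proots_eq_iff_of_monic:
  fixes p :: "complex poly"
  assumes "lead_coeff p = 1"
  shows "proots p = M \<longleftrightarrow> p = (\<Prod>x\<in>#M. [:-x, 1:])"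
proof
  assume "proots p = M"
  with complex_poly_decompose_multiset[of p] assms show "p = (\<Prod>x\<in>#M. [:-x, 1:])"
    by simp
next
  have "(\<Prod>x\<in>#N. [:-x, 1:]) \<noteq> 0" for N :: "complex multiset"
    by (induction N) (simp_all del: mult_pCons_left)
  then have "proots (\<Prod>x\<in>#M. [:-x, 1:]) = M"
    by (induction M) (simp_all add: proots_mult del: mult_pCons_left)
  moreover assume "p = (\<Prod>x\<in>#M. [:-x, 1:])"
  ultimately show "proots p = M"
    by simp
qed

text \<open>
  Comparing coefficients leaves $p + r = 0$, $q + s + pr = \omega^2$, $ps + qr = 0$ and $qs = 0$.
  If $p \neq 0$, then $q = s = 0$ and $-p^2 = \omega^2$, which no real $p$ satisfies.
\<close>
lemma real_quadratic_product_eq_hopf_iff: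
  fixes p q r s \<omega> :: real
  assumes "\<omega> > 0"
  shows "[:q, p, 1:] * [:s, r, 1:] = [:0, 0, \<omega>\<^sup>2, 0, 1:] \<longleftrightarrow>
           p = 0 \<and> r = 0 \<and> (q = 0 \<and> s = \<omega>\<^sup>2 \<or> q = \<omega>\<^sup>2 \<and> s = 0)"
    (is "?L \<longleftrightarrow> ?R")
proof
  assume ?L
  then have eqs: "q * s = 0" "q * r + p * s = 0" "q + p * r + s = \<omega>\<^sup>2" "p + r = 0"
    by (auto simp: algebra_simps)
  then have r: "r = - p" by simp
  have "p = 0"
  proof (rule ccontr)
    assume "p \<noteq> 0"
    have "p * (s - q) = 0"
      using eqs(2) r by (simp add: algebra_simps)
    with \<open>p \<noteq> 0\<close> eqs(1) have "q = 0" "s = 0" by auto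
    with eqs(3) r have "\<omega>\<^sup>2 = - (p\<^sup>2)"
      by (simp add: power2_eq_square)
    then show False
      using assms zero_le_power2[of p] zero_less_power[OF assms, of 2] by linarith
  qed
  with eqs r show ?R by auto
next
  assume ?R
  then show ?L by auto
qed

abbreviation jacobian_at_origin ::
    "real \<Rightarrow> real \<Rightarrow> real \<Rightarrow> real \<Rightarrow> real \<Rightarrow> real \<Rightarrow> real ^ 4 ^ 4" where
  "jacobian_at_origin a b c d e k \<equiv>
     vector [vector [- a, a, 0, 0], vector [b, b, 0, 0],
             vector [0, 0, - c, - e], vector [0, 0, k, - d]]"

lemma vector_field_has_derivative_at_origin:
  "(vector_field a b c d e k has_derivative (\<lambda>h. jacobian_at_origin a b c d e k *v h)) (at 0)"
proof -
  have "((\<lambda>u. vector_field a b c d e k u $ i) has_derivative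
          (\<lambda>h. (jacobian_at_origin a b c d e k *v h) $ i)) (at 0)" for i
    using exhaust_4[of i]
    by (elim disjE; simp only: vector_field_def Let_def vector_4 matrix_vector_mult_def
          vec_lambda_beta sum_4)
      (auto intro!: derivative_eq_intros bounded_linear_imp_has_derivative
         simp: bounded_linear_vec_nth algebra_simps)
  then show ?thesis
    by (subst has_derivative_componentwise_within)
       (auto simp: Basis_vec_def inner_axis)
qed

lemma jacobian_vector_field:
  "jacobian (vector_field a b c d e k) (at 0) = jacobian_at_origin a b c d e k"
  unfolding jacobian_def
    frechet_derivative_at[OF vector_field_has_derivative_at_origin, symmetric]
  by simp

text \<open>The polynomial is stated over the reals and then mapped to the complex numbers, since
  the determination of its coefficients uses that they are real.\<close>
lemma charpoly_jacobian_at_origin: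
  "charpoly (\<chi> i j. complex_of_real (jacobian_at_origin a b c d e k $ i $ j)) =
     map_poly of_real ([:- 2 * a * b, a - b, 1:] * [:c * d + e * k, c + d, 1:])"
  unfolding charpoly_def
  by (subst det_block_lower_triangular_4) (simp_all add: mat_def map_poly_pCons algebra_simps)

lemma zero_hopf_equilibrium_at_frequency_iff:
  "zero_hopf_equilibrium_at_frequency (vector_field a b c d e k) 0 \<omega> \<longleftrightarrow>
     a = 0 \<and> b = 0 \<and> d = - c \<and> \<omega> > 0 \<and> \<omega>\<^sup>2 = e * k - c\<^sup>2"
proof (cases "\<omega> > 0")
  case True
  define P where "P = [:- 2 * a * b, a - b, 1:] * [:c * d + e * k, c + d, 1:]"
  define M where "M = {#0, 0, \<i> * complex_of_real \<omega>, - (\<i> * complex_of_real \<omega>)#}"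
  have equilibrium: "vector_field a b c d e k 0 = 0"
    by (simp add: vector_field_def vec_eq_iff forall_4)
  have diff: "vector_field a b c d e k differentiable (at 0)"
    using vector_field_has_derivative_at_origin by (rule differentiableI)
  have "lead_coeff P = 1"
    unfolding P_def by (simp only: lead_coeff_mult) simp
  then have monic: "lead_coeff (map_poly complex_of_real P) = 1"
    by (simp add: degree_map_poly coeff_map_poly)
  have hopf: "(\<Prod>x\<in>#M. [:-x, 1:]) = map_poly complex_of_real [:0, 0, \<omega>\<^sup>2, 0, 1:]"
    by (simp add: M_def map_poly_pCons power2_eq_square algebra_simps)
  have "zero_hopf_equilibrium_at_frequency (vector_field a b c d e k) 0 \<omega> \<longleftrightarrow>
          proots (map_poly complex_of_real P) = M"
    unfolding zero_hopf_equilibrium_at_frequency_def eigenvalues_mset_def jacobian_vector_field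
      charpoly_jacobian_at_origin
    by (simp only: P_def M_def equilibrium diff True simp_thms)
  also have "\<dots> \<longleftrightarrow> map_poly complex_of_real P = map_poly complex_of_real [:0, 0, \<omega>\<^sup>2, 0, 1:]"
    by (simp only: proots_eq_iff_of_monic[OF monic] hopf)
  also have "\<dots> \<longleftrightarrow> P = [:0, 0, \<omega>\<^sup>2, 0, 1:]"
    by (simp add: poly_eq_iff coeff_map_poly)
  also have "\<dots> \<longleftrightarrow> a - b = 0 \<and> c + d = 0 \<and>
      (- 2 * a * b = 0 \<and> c * d + e * k = \<omega>\<^sup>2 \<or> - 2 * a * b = \<omega>\<^sup>2 \<and> c * d + e * k = 0)"
    unfolding P_def by (rule real_quadratic_product_eq_hopf_iff[OF True])
  also have "\<dots> \<longleftrightarrow> a = 0 \<and> b = 0 \<and> d = - c \<and> \<omega>\<^sup>2 = e * k - c\<^sup>2"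
  proof -
    \<comment> \<open>This excludes the case that the imaginary pair belongs to the block of $x$ and $y$.\<close>
    have "- 2 * a * a \<noteq> \<omega>\<^sup>2"
      using zero_le_square[of a] zero_less_power[OF True, of 2] by linarith
    moreover have "c + d = 0 \<longleftrightarrow> d = - c"
      by linarith
    ultimately show ?thesis
      by (auto simp: power2_eq_square)
  qed
  finally show ?thesis
    using True by simp
qed (simp add: zero_hopf_equilibrium_at_frequency_def)

theorem proposition2:
  fixes a b c d e k :: real
  shows "(zero_hopf_equilibrium (vector_field a b c d e k) 0 \<longleftrightarrow>
            a = 0 \<and> b = 0 \<and> d = - c \<and> e * k - c\<^sup>2 > 0) \<and>
         (\<forall>\<omega>. zero_hopf_equilibrium_at_frequency (vector_field a b c d e k) 0 \<omega> \<longrightarrow>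
            \<omega>\<^sup>2 = e * k - c\<^sup>2)"
proof -
  have "(\<exists>\<omega>>0. \<omega>\<^sup>2 = e * k - c\<^sup>2) \<longleftrightarrow> e * k - c\<^sup>2 > 0"
  proof
    assume "e * k - c\<^sup>2 > 0"
    then have "sqrt (e * k - c\<^sup>2) > 0" "(sqrt (e * k - c\<^sup>2))\<^sup>2 = e * k - c\<^sup>2"
      by simp_all
    then show "\<exists>\<omega>>0. \<omega>\<^sup>2 = e * k - c\<^sup>2" by blast
  qed (metis zero_less_power)
  then show ?thesis
    unfolding zero_hopf_equilibrium_def zero_hopf_equilibrium_at_frequency_iff by blast
qed

end
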